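(* Let $n>m\geqslant 2$, let $G$ be a nonempty set of subsets $g\subset\{1,\ldots,n\}$ with $|g|=m$, and for each $g\in G$ let $\mathcal{I}^{g}$ be a Bell expression in the $n$-partite scenario such that the following two conditions hold. (i) For every $g\in G$, every bipartition $S|\bar S$ of $\{A_1,\ldots,A_n\}$ for which there exist $i,j\in g$ with $A_i\in S$ and $A_j\in\bar S$, and every correlation $\vec p$ that is local across $S|\bar S$, one has $\mathcal{I}^{g}\leqslant 0$ when evaluated on $\vec p$. (ii) Writing $\mathcal{I}^{g}=\mathcal{I}^{g}_{+}-\mathcal{I}^{g}_{-}$ for the decomposition of $\mathcal{I}^{g}$ into its positive and negative parts, the positive parts all coincide: $\mathcal{I}^{g}_{+}=\mathcal{I}^{g'}_{+}=:\mathcal{I}_{+}$ for all $g,g'\in G$. Let $T$ be the common term of all the negative parts $\mathcal{I}^{g}_{-}$, $g\in G$. For a bipartition $S|\bar S$ let $$G'=G'(S|\bar S)=\{g\in G \,:\, \{A_i\}_{i\in g}\subset S \ \text{ or }\ \{A_i\}_{i\in g}\subset\bar S\},$$ and let $\gamma=\max_{S|\bar S}|G'(S|\bar S)|$, the maximum being over all bipartitions. Then violation of the Bell inequality $$\sum_{g\in G}\mathcal{I}^{g}\leqslant\gamma\,(\mathcal{I}_{+}-T)$$ certifies genuine multipartite nonlocality: every correlation $\vec p$ for which $\sum_{g\in G}\mathcal{I}^{g}>\gamma(\mathcal{I}_{+}-T)$ is genuinely multipartite nonlocal (GMNL).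
   Context: Scenario. There are $n$ parties $A_1,\ldots,A_n$. Party $A_i$ chooses a measurement setting $x_i$ from a finite set and obtains an outcome $a_i$ from a finite set. A correlation is a family $\vec p=\{p(\boldsymbol a|\boldsymbol x)\}$, where $\boldsymbol a=(a_1,\ldots,a_n)$, $\boldsymbol x=(x_1,\ldots,x_n)$ and $p(\cdot|\boldsymbol x)$ is a probability distribution for each $\boldsymbol x$. For a set $S$ of parties, $\boldsymbol a_S,\boldsymbol x_S$ denote the outcomes and settings of the parties in $S$. Bipartitions and locality. A bipartition $S|\bar S$ is a partition of $\{A_1,\ldots,A_n\}$ into two disjoint nonempty sets $S$ and $\bar S$. A correlation $\vec p$ is local across $S|\bar S$ if $$p(\boldsymbol a|\boldsymbol x)=\sum_\lambda q_\lambda\, p_S(\boldsymbol a_S|\boldsymbol x_S,\lambda)\,p_{\bar S}(\boldsymbol a_{\bar S}|\boldsymbol x_{\bar S},\lambda),$$ where $q_\lambda$ is a probability distribution and, for each $\lambda$, $p_S(\cdot|\cdot,\lambda)$ and $p_{\bar S}(\cdot|\cdot,\lambda)$ are families of conditional probability distributions satisfying the no-signaling principle (the marginal distribution of the outcomes of any subset of the parties does not depend on the settings of the other parties). A correlation is bilocal if it is a convex combination $p(\boldsymbol a|\boldsymbol x)=\sum_{S|\bar S}r_{S|\bar S}\,p_{S|\bar S}(\boldsymbol a|\boldsymbol x)$ over bipartitions, where each $p_{S|\bar S}$ is local across $S|\bar S$. A correlation is genuinely multipartite nonlocal (GMNL) if it is not bilocal. Bell expressions. A Bell expression is a formal real linear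 combination of the probabilities $p(\boldsymbol a|\boldsymbol x)$, evaluated on correlations $\vec p$. (Typically $\mathcal{I}^g$ arises from an $m$-partite Bell expression for the parties $\{A_i\}_{i\in g}$ by lifting it to $n$ parties, i.e. by fixing the settings and outcomes of the remaining $n-m$ parties; only conditions (i) and (ii) of the claim are required.) The positive part $\mathcal{I}^g_+$ consists of the terms of $\mathcal{I}^g$ with positive coefficients, and $\mathcal{I}^g_-$ is minus the sum of the terms with negative coefficients, so both $\mathcal{I}^g_\pm$ are linear combinations of probabilities with nonnegative coefficients. The common term $T$ of the negative parts is the combination of probabilities shared by all the $\mathcal{I}^g_-$, $g\in G$: the coefficient of $p(\boldsymbol a|\boldsymbol x)$ in $T$ is the minimum over $g\in G$ of its coefficients in $\mathcal{I}^g_-$ (so $T=0$ if the negative parts share no common terms). *)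

theory Defs
  imports "HOL-Probability.Probability_Mass_Function" "HOL-Library.Disjoint_Sets"
begin

text \<open>
  Parties are natural numbers. Throughout, \<open>N\<close> or \<open>S\<close> is a finite set of parties, \<open>A i\<close> and \<open>X i\<close>
  are the outcome set and the setting set of party \<open>i\<close>. Joint outcomes \<open>a\<close> and joint settings \<open>x\<close>
  of \<open>S\<close> are elements of \<open>PiE S A\<close> and \<open>PiE S X\<close>, so that \<open>restrict a R\<close> is the subvector of \<open>a\<close>
  belonging to \<open>R \<subseteq> S\<close>. The probability written p(a|x) on paper is \<open>pmf (p x) a\<close>; values of \<open>p\<close>
  at arguments outside \<open>PiE S X\<close> are irrelevant.
\<close>

type_synonym ('a, 'x) corr = "(nat \<Rightarrow> 'x) \<Rightarrow> (nat \<Rightarrow> 'a) pmf"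

definition correlation ::
  "nat set \<Rightarrow> (nat \<Rightarrow> 'a set) \<Rightarrow> (nat \<Rightarrow> 'x set) \<Rightarrow> ('a, 'x) corr \<Rightarrow> bool" where
  "correlation S A X p \<longleftrightarrow> (\<forall>x\<in>PiE S X. set_pmf (p x) \<subseteq> PiE S A)"

text \<open>The marginal on \<open>R\<close> is the push-forward under restriction to \<open>R\<close>.\<close>

definition no_signaling ::
  "nat set \<Rightarrow> (nat \<Rightarrow> 'a set) \<Rightarrow> (nat \<Rightarrow> 'x set) \<Rightarrow> ('a, 'x) corr \<Rightarrow> bool" where
  "no_signaling S A X p \<longleftrightarrow> correlation S A X p \<and>
     (\<forall>R\<subseteq>S. \<forall>x\<in>PiE S X. \<forall>y\<in>PiE S X. restrict x R = restrict y R \<longrightarrow>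
        map_pmf (\<lambda>a. restrict a R) (p x) = map_pmf (\<lambda>a. restrict a R) (p y))"

text \<open>A bipartition is unordered: it is the two-element set of its parts.\<close>

definition bipartitions :: "nat set \<Rightarrow> nat set set set" where
  "bipartitions N = {P. partition_on N P \<and> card P = 2}"

text \<open>
  The hidden variable \<open>l\<close> ranges over the natural numbers; finite mixtures are those with a
  finitely supported \<open>q\<close>. The product over \<open>S \<in> P\<close> consists of the two factors belonging to the
  two parts of the bipartition.
\<close>

definition local_across ::
  "nat set \<Rightarrow> (nat \<Rightarrow> 'a set) \<Rightarrow> (nat \<Rightarrow> 'x set) \<Rightarrow> nat set set \<Rightarrow> ('a, 'x) corr \<Rightarrow> bool" where
  "local_across N A X P p \<longleftrightarrow> correlation N A X p \<and>
     (\<exists>(q :: nat pmf) (c :: nat set \<Rightarrow> nat \<Rightarrow> ('a, 'x) corr).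
        (\<forall>S\<in>P. \<forall>l. no_signaling S A X (c S l)) \<and>
        (\<forall>x\<in>PiE N X. \<forall>a\<in>PiE N A.
           (\<lambda>l. pmf q l * (\<Prod>S\<in>P. pmf (c S l (restrict x S)) (restrict a S)))
             sums pmf (p x) a))"

definition bilocal ::
  "nat set \<Rightarrow> (nat \<Rightarrow> 'a set) \<Rightarrow> (nat \<Rightarrow> 'x set) \<Rightarrow> ('a, 'x) corr \<Rightarrow> bool" where
  "bilocal N A X p \<longleftrightarrow> correlation N A X p \<and>
     (\<exists>(r :: nat set set pmf) (d :: nat set set \<Rightarrow> ('a, 'x) corr).
        set_pmf r \<subseteq> bipartitions N \<and>
        (\<forall>P\<in>bipartitions N. local_across N A X P (d P)) \<and>
        (\<forall>x\<in>PiE N X. \<forall>a\<in>PiE N A.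
           pmf (p x) a = (\<Sum>P\<in>bipartitions N. pmf r P * pmf (d P x) a)))"

definition GMNL ::
  "nat set \<Rightarrow> (nat \<Rightarrow> 'a set) \<Rightarrow> (nat \<Rightarrow> 'x set) \<Rightarrow> ('a, 'x) corr \<Rightarrow> bool" where
  "GMNL N A X p \<longleftrightarrow> correlation N A X p \<and> \<not> bilocal N A X p"

text \<open>
  A Bell expression is given by its coefficients: \<open>I a x\<close> is the coefficient of p(a|x). Only the
  coefficients at \<open>a \<in> PiE N A\<close>, \<open>x \<in> PiE N X\<close> are meaningful.
\<close>

type_synonym ('a, 'x) bell_expr = "(nat \<Rightarrow> 'a) \<Rightarrow> (nat \<Rightarrow> 'x) \<Rightarrow> real"

definition bell_value ::
  "nat set \<Rightarrow> (nat \<Rightarrow> 'a set) \<Rightarrow> (nat \<Rightarrow> 'x set) \<Rightarrow> ('a, 'x) bell_expr \<Rightarrow> ('a, 'x) corr \<Rightarrow> real" where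
  "bell_value N A X I p = (\<Sum>x\<in>PiE N X. \<Sum>a\<in>PiE N A. I a x * pmf (p x) a)"

definition bell_pos :: "('a, 'x) bell_expr \<Rightarrow> ('a, 'x) bell_expr" where
  "bell_pos I = (\<lambda>a x. max (I a x) 0)"

definition bell_neg :: "('a, 'x) bell_expr \<Rightarrow> ('a, 'x) bell_expr" where
  "bell_neg I = (\<lambda>a x. max (- I a x) 0)"

definition common_neg ::
  "nat set set \<Rightarrow> (nat set \<Rightarrow> ('a, 'x) bell_expr) \<Rightarrow> ('a, 'x) bell_expr" where
  "common_neg G I = (\<lambda>a x. Min ((\<lambda>g. bell_neg (I g) a x) ` G))"

definition unsplit :: "nat set set \<Rightarrow> nat set set \<Rightarrow> nat set set" where
  "unsplit G P = {g \<in> G. \<exists>S\<in>P. g \<subseteq> S}"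

definition max_unsplit :: "nat set \<Rightarrow> nat set set \<Rightarrow> nat" where
  "max_unsplit N G = Max ((\<lambda>P. card (unsplit G P)) ` bipartitions N)"

end

theory Submission imports Defs
begin

text \<open>
  By linearity it suffices to bound \<open>\<Sum>g\<in>G. I\<^sup>g\<close> on a correlation that is local across a single
  bipartition. There, with \<open>v = I\<^sub>+ - T\<close>, every \<open>I\<^sup>g\<close> is at most \<open>v\<close>, and those split by the
  bipartition are at most \<open>0\<close>. If \<open>v \<ge> 0\<close>, only the at most \<open>\<gamma>\<close> unsplit \<open>g\<close> contribute, each at most
  \<open>v\<close>. If \<open>v < 0\<close>, all \<open>g\<close> contribute at most \<open>v\<close>, and \<open>\<gamma> \<le> |G|\<close> gives \<open>|G| v \<le> \<gamma> v\<close>.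
\<close>

lemma bell_value_diff:
  "bell_value N A X (\<lambda>a x. I a x - J a x) p = bell_value N A X I p - bell_value N A X J p"
  by (simp add: bell_value_def left_diff_distrib sum_subtractf)

lemma bell_value_mono:
  assumes "\<And>a x. \<lbrakk>a \<in> PiE N A; x \<in> PiE N X\<rbrakk> \<Longrightarrow> I a x \<le> J a x"
  shows "bell_value N A X I p \<le> bell_value N A X J p"
  unfolding bell_value_def by (intro sum_mono mult_right_mono assms) auto

text \<open>A Bell value is a finite linear form in the probabilities, so it passes through the sum
  over \<open>B\<close>. With the bipartition weights as \<open>w\<close>, this reduces a bilocal
  correlation to its local components.\<close>

lemma bell_value_mixture:
  assumes "\<And>a x. \<lbrakk>a \<in> PiE N A; x \<in> PiE N X\<rbrakk>
    \<Longrightarrow> pmf (p x) a = (\<Sum>P\<in>B. w P * pmf (d P x) a)"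
  shows "bell_value N A X I p = (\<Sum>P\<in>B. w P * bell_value N A X I (d P))"
proof -
  have "bell_value N A X I p
      = (\<Sum>x\<in>PiE N X. \<Sum>a\<in>PiE N A. \<Sum>P\<in>B. w P * (I a x * pmf (d P x) a))"
    unfolding bell_value_def
    by (intro sum.cong refl) (simp add: assms sum_distrib_left mult_ac)
  also have "\<dots> = (\<Sum>x\<in>PiE N X. \<Sum>P\<in>B. \<Sum>a\<in>PiE N A. w P * (I a x * pmf (d P x) a))"
    by (intro sum.cong refl sum.swap)
  also have "\<dots> = (\<Sum>P\<in>B. \<Sum>x\<in>PiE N X. \<Sum>a\<in>PiE N A. w P * (I a x * pmf (d P x) a))"
    by (rule sum.swap)
  finally show ?thesis
    by (simp add: bell_value_def sum_distrib_left)
qed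

lemma common_neg_le:
  assumes "finite G" "g \<in> G"
  shows "common_neg G I a x \<le> bell_neg (I g) a x"
  unfolding common_neg_def using assms by (intro Min_le) auto

lemma bell_pos_minus_neg: "bell_pos I a x - bell_neg I a x = I a x"
  by (simp add: bell_pos_def bell_neg_def max_def)

lemma finite_bipartitions:
  assumes "finite N"
  shows "finite (bipartitions N)"
proof (rule finite_subset)
  show "bipartitions N \<subseteq> Pow (Pow N)"
    by (auto simp: bipartitions_def partition_on_def)
qed (use assms in simp)

text \<open>Supplies the splitting premise of condition (i): the block of some \<open>i\<close> in
  \<open>g\<close> cannot contain all of \<open>g\<close>, and any \<open>j\<close> it misses is
  covered by a different block.\<close>

lemma not_unsplit_imp_split:
  assumes "partition_on N P" "g \<in> G" "g \<subseteq> N" "g \<noteq> {}" "g \<notin> unsplit G P"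
  shows "\<exists>S\<in>P. \<exists>S'\<in>P. S \<noteq> S' \<and> (\<exists>i\<in>g. \<exists>j\<in>g. i \<in> S \<and> j \<in> S')"
proof -
  have un: "\<Union>P = N" using assms(1) by (auto simp: partition_on_def)
  obtain i where i: "i \<in> g" using assms(4) by blast
  then obtain S where S: "S \<in> P" "i \<in> S" using assms(3) un by blast
  then obtain j where j: "j \<in> g" "j \<notin> S" using assms(2,5) by (auto simp: unsplit_def)
  then obtain S' where "S' \<in> P" "j \<in> S'" using assms(3) un by blast
  with i S j show ?thesis by blast
qed

lemma card_unsplit_le_max_unsplit:
  assumes "finite N" "P \<in> bipartitions N"
  shows "card (unsplit G P) \<le> max_unsplit N G"
  unfolding max_unsplit_def using assms finite_bipartitions by (intro Max_ge) auto

text \<open>Every \<open>unsplit G P\<close> is a subset of \<open>G\<close>; a bipartition must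
  exist for the \<open>Max\<close> to be taken over a nonempty set.\<close>

lemma max_unsplit_le_card:
  assumes "finite N" "finite G" "bipartitions N \<noteq> {}"
  shows "max_unsplit N G \<le> card G"
  unfolding max_unsplit_def using assms
  by (intro Max.boundedI) (auto simp: finite_bipartitions unsplit_def intro!: card_mono)

text \<open>Isolates the case split on the sign of \<open>v\<close>. In the application
  \<open>U\<close> is the set of unsplit \<open>g\<close> and \<open>k\<close> is \<gamma>.\<close>

lemma sum_le_of_subset_bound:
  fixes f :: "'b \<Rightarrow> real"
  assumes "finite G" "U \<subseteq> G" "card U \<le> k" "k \<le> card G"
    and "\<And>g. g \<in> G \<Longrightarrow> f g \<le> v"
    and "\<And>g. g \<in> G - U \<Longrightarrow> f g \<le> 0"
  shows "sum f G \<le> real k * v"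
proof (cases "0 \<le> v")
  case True
  have "sum f G = sum f (G - U) + sum f U"
    using assms(1,2) by (rule sum.subset_diff[rotated])
  also have "\<dots> \<le> 0 + real (card U) * v"
    using assms(2,5,6) by (intro add_mono sum_nonpos sum_bounded_above) auto
  also have "\<dots> \<le> real k * v"
    using True assms(3) by (simp add: mult_right_mono)
  finally show ?thesis .
next
  case False
  have "sum f G \<le> real (card G) * v"
    using assms(5) by (rule sum_bounded_above)
  \<comment> \<open>A negative factor \<open>v\<close> reverses
    \<open>k \<le> card G\<close>.\<close>
  also have "\<dots> \<le> real k * v"
    using False assms(4) by (intro mult_right_mono_neg) auto
  finally show ?thesis .
qed

theorem theorem1:
  fixes n m :: nat
    and A :: "nat \<Rightarrow> 'a set" and X :: "nat \<Rightarrow> 'x set"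
    and G :: "nat set set"
    and I :: "nat set \<Rightarrow> ('a, 'x) bell_expr"
    and Iplus :: "('a, 'x) bell_expr"
    and p :: "('a, 'x) corr"
  assumes "2 \<le> m" and "m < n"
    and "\<And>i. i \<in> {1..n} \<Longrightarrow> finite (A i)"
    and "\<And>i. i \<in> {1..n} \<Longrightarrow> finite (X i)"
    and "G \<noteq> {}"
    and "\<And>g. g \<in> G \<Longrightarrow> g \<subseteq> {1..n} \<and> card g = m"
    and cond_i: "\<And>g P p'. \<lbrakk>g \<in> G; P \<in> bipartitions {1..n};
          \<exists>S\<in>P. \<exists>S'\<in>P. S \<noteq> S' \<and> (\<exists>i\<in>g. \<exists>j\<in>g. i \<in> S \<and> j \<in> S');
          local_across {1..n} A X P p'\<rbrakk>
        \<Longrightarrow> bell_value {1..n} A X (I g) p' \<le> 0"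
    and cond_ii: "\<And>g a x. \<lbrakk>g \<in> G; a \<in> PiE {1..n} A; x \<in> PiE {1..n} X\<rbrakk>
        \<Longrightarrow> bell_pos (I g) a x = Iplus a x"
    and "correlation {1..n} A X p"
    and "(\<Sum>g\<in>G. bell_value {1..n} A X (I g) p)
           > real (max_unsplit {1..n} G) *
             (bell_value {1..n} A X Iplus p - bell_value {1..n} A X (common_neg G I) p)"
  shows "GMNL {1..n} A X p"
proof -
  let ?N = "{1..n}"
  let ?B = "bipartitions ?N"
  let ?V = "bell_value ?N A X"
  let ?k = "max_unsplit ?N G"
  let ?v = "\<lambda>p'. ?V Iplus p' - ?V (common_neg G I) p'"
  have finG: "finite G"
    using assms(6) by (intro finite_subset[of G "Pow ?N"]) auto
  \<comment> \<open>Coefficientwise, \<open>I g\<close> is \<open>Iplus\<close> minus its negative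
    part, which dominates the common term; probabilities are nonnegative, so the values compare
    likewise.\<close>
  have le_v: "?V (I g) p' \<le> ?v p'" if g: "g \<in> G" for g p'
  proof -
    have "?V (I g) p' \<le> ?V (\<lambda>a x. Iplus a x - common_neg G I a x) p'"
    proof (rule bell_value_mono)
      fix a x assume ax: "a \<in> PiE ?N A" "x \<in> PiE ?N X"
      show "I g a x \<le> Iplus a x - common_neg G I a x"
        using common_neg_le[OF finG g, of I a x] cond_ii[OF g ax] bell_pos_minus_neg[of "I g" a x]
        by linarith
    qed
    then show ?thesis by (simp only: bell_value_diff)
  qed
  have local_bound: "(\<Sum>g\<in>G. ?V (I g) p') \<le> real ?k * ?v p'"
    if P: "P \<in> ?B" and loc: "local_across ?N A X P p'" for P p'
  proof (rule sum_le_of_subset_bound[OF finG, where U = "unsplit G P"])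
    show "unsplit G P \<subseteq> G" by (auto simp: unsplit_def)
    show "card (unsplit G P) \<le> ?k" using P by (intro card_unsplit_le_max_unsplit) auto
    show "?k \<le> card G" using P finG by (intro max_unsplit_le_card) auto
    show "?V (I g) p' \<le> ?v p'" if "g \<in> G" for g using le_v[OF that] .
    show "?V (I g) p' \<le> 0" if g: "g \<in> G - unsplit G P" for g
    proof (rule cond_i[OF _ P _ loc])
      \<comment> \<open>The empty set has cardinality 0, but
        \<open>card g = m \<ge> 2\<close>.\<close>
      have "g \<noteq> {}" using assms(1,6) g by fastforce
      then show "\<exists>S\<in>P. \<exists>S'\<in>P. S \<noteq> S' \<and> (\<exists>i\<in>g. \<exists>j\<in>g. i \<in> S \<and> j \<in> S')"
        using P g assms(6) by (intro not_unsplit_imp_split[of ?N P g G]) (auto simp: bipartitions_def)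
    qed (use g in simp)
  qed
  have "\<not> bilocal ?N A X p"
  proof
    assume "bilocal ?N A X p"
    then obtain r d where d: "\<forall>P\<in>?B. local_across ?N A X P (d P)"
      and mix: "\<forall>x\<in>PiE ?N X. \<forall>a\<in>PiE ?N A.
        pmf (p x) a = (\<Sum>P\<in>?B. pmf r P * pmf (d P x) a)"
      unfolding bilocal_def by (elim conjE exE)
    have V: "?V J p = (\<Sum>P\<in>?B. pmf r P * ?V J (d P))" for J
      by (rule bell_value_mixture) (rule mix[rule_format])
    have "(\<Sum>g\<in>G. ?V (I g) p) = (\<Sum>P\<in>?B. pmf r P * (\<Sum>g\<in>G. ?V (I g) (d P)))"
      unfolding V sum_distrib_left by (rule sum.swap)
    \<comment> \<open>The weights are nonnegative, so the local bounds can be averaged.\<close>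
    also have "\<dots> \<le> (\<Sum>P\<in>?B. pmf r P * (real ?k * ?v (d P)))"
    proof (intro sum_mono mult_left_mono pmf_nonneg)
      fix P assume P: "P \<in> ?B"
      from d P have "local_across ?N A X P (d P)" by (rule bspec)
      with P show "(\<Sum>g\<in>G. ?V (I g) (d P)) \<le> real ?k * ?v (d P)"
        by (rule local_bound)
    qed
    also have "\<dots> = real ?k * ?v p"
      \<comment> \<open>The bound is itself linear in the correlation: \<open>V\<close> expands
        \<open>?V Iplus p\<close> and the value of the common term into the same average.\<close>
      unfolding V by (simp add: sum_distrib_left sum_subtractf algebra_simps)
    finally show False using assms(10) by linarith
  qed
  with assms(9) show ?thesis by (simp add: GMNL_def)
qed

end
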